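(* $\theta^{\rm U}(2,2)>0$ and $\theta^{\rm U}(3,3)>0$.
   Context: For integers $d\ge1$ and $1\le k\le 2d$, let each vertex $x\in\mathbb{Z}^d$, independently of all others, choose a uniformly random subset of exactly $k$ of its $2d$ nearest neighbors (in $\ell_1$-distance). The undirected $k$-neighbor graph ($k$-UnG) on $\mathbb{Z}^d$ has an undirected edge between nearest neighbors $x,y$ whenever $x$ chose $y$ or $y$ chose $x$ (or both). We write $\theta^{\rm U}(k,d)=\mathbb{P}(o\rightsquigarrow\infty\text{ in the $k$-UnG on }\mathbb{Z}^d)$, where $o$ is the origin and $o\rightsquigarrow\infty$ is the event that there is an infinite self-avoiding path of edges of the $k$-UnG starting at $o$. *)

theory Defs
  imports "HOL-Probability.Probability"
begin

definition zd :: "nat \<Rightarrow> int list set" where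
  "zd d = {x. length x = d}"

definition nbrs :: "int list \<Rightarrow> int list set" where
  "nbrs x = {y. length y = length x \<and> (\<Sum>i<length x. \<bar>x ! i - y ! i\<bar>) = 1}"

definition choice_space :: "nat \<Rightarrow> nat \<Rightarrow> (int list \<Rightarrow> int list set) measure" where
  "choice_space d k = PiM (zd d)
     (\<lambda>x. measure_pmf (pmf_of_set {S. S \<subseteq> nbrs x \<and> card S = k}))"

definition ung_edge :: "(int list \<Rightarrow> int list set) \<Rightarrow> int list \<Rightarrow> int list \<Rightarrow> bool" where
  "ung_edge \<omega> x y \<longleftrightarrow> y \<in> nbrs x \<and> (y \<in> \<omega> x \<or> x \<in> \<omega> y)"

definition perc_event :: "nat \<Rightarrow> nat \<Rightarrow> (int list \<Rightarrow> int list set) set" where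
  "perc_event d k = {\<omega> \<in> space (choice_space d k).
     \<exists>p :: nat \<Rightarrow> int list. p 0 = replicate d 0 \<and> inj p \<and>
       (\<forall>n. ung_edge \<omega> (p n) (p (Suc n)))}"

definition theta_U :: "nat \<Rightarrow> nat \<Rightarrow> real" where
  "theta_U k d = measure (choice_space d k) (perc_event d k)"

end

theory Submission
  imports Defs
begin

text \<open>
  A Peierls argument in the quadrant of a coordinate plane, valid for \<open>k = d\<close> in every
  dimension \<open>d \<ge> 2\<close>. A vertex avoids \<open>j\<close> prescribed neighbours with probability at
  most \<open>2^-j\<close>, so \<open>n\<close> given edges are all closed with probability at most \<open>4^-n\<close>.
  If the cluster of the origin is finite, consider its trace on the quadrant and follow the dual
  contours separating the trace from its complement. Along the bottom side there is one more
  place where a contour enters the quadrant than where one leaves it, and distinct contours have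
  distinct ends, so some contour runs from the bottom side, at distance \<open>i + 1/2\<close> from the
  corner, to the left side. It crosses at least \<open>i + 2\<close> closed edges and turns in one of
  three ways at each step. The union bound
  \<open>\<Sum>i. 3^(i+1) 4^-(i+2) = 3/4 < 1\<close> leaves probability at least \<open>1/4\<close> for percolation.
\<close>

section \<open>Probability that given edges are closed\<close>

lemma nbrs_eq_image:
  "nbrs x = (\<lambda>(i, s). x[i := x ! i + s]) ` ({..<length x} \<times> {1, -1})"
proof (intro set_eqI iffI)
  fix y assume "y \<in> nbrs x"
  then have len: "length y = length x" and s: "(\<Sum>i<length x. \<bar>x ! i - y ! i\<bar>) = 1"
    by (auto simp: nbrs_def)
  \<comment> \<open>Moved to \<open>nat\<close>, where a finite sum equals 1 only if one term is 1
    and all others vanish.\<close>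
  have "int (\<Sum>i<length x. nat \<bar>x ! i - y ! i\<bar>) = 1"
    using s by simp
  then have "(\<Sum>i<length x. nat \<bar>x ! i - y ! i\<bar>) = 1"
    by linarith
  then obtain i where i: "i < length x" "nat \<bar>x ! i - y ! i\<bar> = 1"
      "\<And>j. j < length x \<Longrightarrow> i \<noteq> j \<Longrightarrow> nat \<bar>x ! j - y ! j\<bar> = 0"
    by (subst (asm) sum_eq_1_iff) auto
  have "y = x[i := x ! i + (y ! i - x ! i)]"
    using len i(1,3) by (intro nth_equalityI) (auto simp: nth_list_update)
  moreover have "y ! i - x ! i \<in> {1, -1}"
    using i(2) by auto
  ultimately show "y \<in> (\<lambda>(i, s). x[i := x ! i + s]) ` ({..<length x} \<times> {1, -1})"
    using i(1) by (intro image_eqI[where x = "(i, y ! i - x ! i)"]) auto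
next
  fix y assume "y \<in> (\<lambda>(i, s). x[i := x ! i + s]) ` ({..<length x} \<times> {1, -1})"
  then obtain i s where i: "i < length x" "s \<in> {1, -1}" "y = x[i := x ! i + s]"
    by auto
  have "(\<Sum>j<length x. \<bar>x ! j - y ! j\<bar>) = (\<Sum>j<length x. if j = i then 1 else 0)"
    using i by (intro sum.cong) (auto simp: nth_list_update)
  then show "y \<in> nbrs x"
    using i by (auto simp: nbrs_def)
qed

lemma finite_nbrs: "finite (nbrs x)"
  by (simp add: nbrs_eq_image)

lemma card_nbrs: "card (nbrs x) = 2 * length x"
proof -
  have "inj_on (\<lambda>(i, s). x[i := x ! i + s]) ({..<length x} \<times> {1, -1 :: int})"
  proof (rule inj_onI, clarify)
    fix i j s t
    assume a: "i < length x" "j < length x" "s \<in> {1, -1 :: int}" "t \<in> {1, -1 :: int}"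
      and eq: "x[i := x ! i + s] = x[j := x ! j + t]"
    have "x[i := x ! i + s] ! i = x[j := x ! j + t] ! i"
      using eq by simp
    then show "i = j \<and> s = t"
      using a by (cases "i = j") (auto simp: nth_list_update)
  qed
  then show ?thesis
    by (simp add: nbrs_eq_image card_image card_cartesian_product)
qed

lemma nbrs_sym: "y \<in> nbrs x \<longleftrightarrow> x \<in> nbrs y"
  by (auto simp: nbrs_def abs_minus_commute)

text \<open>By Pascal's rule \<open>Suc m choose d\<close> splits into \<open>m choose d\<close> and
  \<open>m choose (d - 1)\<close>. For \<open>m < 2 * d\<close> the latter is at least as large,
  since \<open>d - 1\<close> is not below \<open>m div 2\<close>. So each excluded element at least
  halves the number of \<open>d\<close>-subsets.\<close>

lemma choose_halving:
  assumes "j \<le> d"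
  shows "2 ^ j * ((2 * d - j) choose d) \<le> (2 * d) choose d"
  using assms
proof (induction j)
  case (Suc j)
  define m where "m = 2 * d - Suc j"
  have m: "2 * d - j = Suc m" "m < 2 * d" "d \<le> m"
    using Suc.prems by (auto simp: m_def)
  obtain c where c: "d = Suc c"
    using Suc.prems by (cases d) auto
  have "m choose d \<le> m choose c"
    using m by (intro binomial_antimono) (auto simp: c)
  then have "2 * (m choose d) \<le> Suc m choose d"
    by (simp add: c)
  then have "2 ^ j * (2 * (m choose d)) \<le> 2 ^ j * (Suc m choose d)"
    by (rule mult_left_mono) simp
  also have "\<dots> \<le> (2 * d) choose d"
    using Suc m by simp
  finally show ?case
    by (simp add: m_def ac_simps)
qed simp

lemma prob_avoid_le:
  assumes "length x = d" "J \<subseteq> nbrs x"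
  shows "measure (measure_pmf (pmf_of_set {S. S \<subseteq> nbrs x \<and> card S = d})) {S. S \<inter> J = {}}
    \<le> (1 / 2) ^ card J"
proof -
  let ?A = "{S. S \<subseteq> nbrs x \<and> card S = d}"
  have fin: "finite ?A"
    using finite_nbrs by auto
  have cA: "card ?A = (2 * d) choose d"
    by (simp add: n_subsets finite_nbrs card_nbrs assms)
  then have ne: "?A \<noteq> {}"
    using card.empty by (metis binomial_eq_0_iff le_add2 mult_2 not_le)
  have finJ: "finite J"
    using assms finite_nbrs finite_subset by blast
  have "?A \<inter> {S. S \<inter> J = {}} = {S. S \<subseteq> nbrs x - J \<and> card S = d}"
    by auto
  then have cB: "card (?A \<inter> {S. S \<inter> J = {}}) = (2 * d - card J) choose d"
    using assms finJ by (simp add: n_subsets finite_nbrs card_nbrs card_Diff_subset)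
  have "2 ^ card J * ((2 * d - card J) choose d) \<le> (2 * d) choose d"
  proof (cases "card J \<le> d")
    case True
    then show ?thesis by (rule choose_halving)
  next
    case False
    \<comment> \<open>Fewer than \<open>d\<close> neighbours remain to choose from. The bound on
      \<open>card J\<close> rules out the degenerate \<open>d = 0\<close>.\<close>
    then have "(2 * d - card J) choose d = 0"
      using card_mono[OF finite_nbrs assms(2)] by (simp add: card_nbrs assms(1))
    then show ?thesis by (simp only: mult_0_right)
  qed
  then have "real (2 ^ card J * ((2 * d - card J) choose d)) \<le> real ((2 * d) choose d)"
    by (rule of_nat_mono)
  moreover have "0 < (2 * d) choose d"
    by simp
  ultimately show ?thesis
    unfolding measure_pmf_of_set[OF ne fin] cA cB
    by (simp add: power_one_over field_simps)
qed

text \<open>A closed edge forbids one choice at each of its two endpoints. Grouping the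
  \<open>2 * card F\<close> forbidden choices by vertex and using independence, the probability is a
  product of avoidance probabilities. By \<open>asym\<close> no undirected edge is counted
  twice.\<close>

lemma prob_closed_le:
  assumes fin: "finite F"
    and nb: "\<And>x y. (x, y) \<in> F \<Longrightarrow> x \<in> zd d \<and> y \<in> nbrs x"
    and asym: "\<And>x y. (x, y) \<in> F \<Longrightarrow> (y, x) \<notin> F"
  shows "measure (choice_space d d)
      {\<omega> \<in> space (choice_space d d). \<forall>(x, y)\<in>F. \<not> ung_edge \<omega> x y} \<le> (1 / 4) ^ card F"
proof -
  let ?p = "\<lambda>x. measure_pmf (pmf_of_set {S. S \<subseteq> nbrs x \<and> card S = d})"
  interpret product_prob_space ?p "zd d"
    by unfold_locales
  have emb: "prod_emb (zd d) ?p D (Pi\<^sub>E D X) = {\<omega> \<in> space (PiM (zd d) ?p). \<forall>v\<in>D. \<omega> v \<in> X v}"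
    if "D \<subseteq> zd d" for D X
    unfolding prod_emb_def using that by (auto simp: space_PiM Pi_iff)
  \<comment> \<open>A pair \<open>(v, u)\<close> in \<open>G\<close> means that \<open>v\<close>
    must not choose \<open>u\<close>; \<open>J v\<close> collects what is forbidden at
    \<open>v\<close>.\<close>
  define G where "G = F \<union> F\<inverse>"
  define J where "J v = {u. (v, u) \<in> G}" for v
  have finG: "finite G"
    using fin by (simp add: G_def)
  have dom: "Domain G \<subseteq> zd d"
    using nb by (fastforce simp: G_def nbrs_def zd_def)
  have Jn: "J v \<subseteq> nbrs v" for v
    using nb nbrs_sym by (fastforce simp: J_def G_def)
  have finJ: "finite (J v)" for v
    using Jn finite_nbrs finite_subset by blast
  have "F \<inter> F\<inverse> = {}"
    using asym by auto
  then have "card G = card F + card (F\<inverse>)"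
    unfolding G_def using fin by (intro card_Un_disjoint) auto
  then have "card G = 2 * card F"
    using card_inverse[of F] by simp
  moreover have "G = (SIGMA v : Domain G. J v)"
    by (auto simp: J_def)
  then have "card G = (\<Sum>v\<in>Domain G. card (J v))"
    using card_SigmaI[of "Domain G" J] finJ finite_Domain[OF finG] by simp
  ultimately have cardJ: "(\<Sum>v\<in>Domain G. card (J v)) = 2 * card F"
    by simp
  have "{\<omega> \<in> space (PiM (zd d) ?p). \<forall>(x, y)\<in>F. \<not> ung_edge \<omega> x y}
      = {\<omega> \<in> space (PiM (zd d) ?p). \<forall>v\<in>Domain G. \<omega> v \<in> {S. S \<inter> J v = {}}}"
    using nb by (fastforce simp: ung_edge_def J_def G_def)
  then have "measure (choice_space d d)
      {\<omega> \<in> space (choice_space d d). \<forall>(x, y)\<in>F. \<not> ung_edge \<omega> x y}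
      = measure (PiM (zd d) ?p)
         {\<omega> \<in> space (PiM (zd d) ?p). \<forall>v\<in>Domain G. \<omega> v \<in> {S. S \<inter> J v = {}}}"
    by (simp add: choice_space_def)
  also have "\<dots> = measure (PiM (zd d) ?p)
      (prod_emb (zd d) ?p (Domain G) (\<Pi>\<^sub>E v\<in>Domain G. {S. S \<inter> J v = {}}))"
    using emb[OF dom] by simp
  also have "\<dots> = (\<Prod>v\<in>Domain G. measure (?p v) {S. S \<inter> J v = {}})"
    using dom finite_Domain[OF finG] by (intro measure_PiM_emb) auto
  also have "\<dots> \<le> (\<Prod>v\<in>Domain G. (1 / 2) ^ card (J v))"
    using dom Jn by (intro prod_mono conjI prob_avoid_le measure_nonneg) (auto simp: zd_def)
  also have "\<dots> = (1 / 2) ^ (2 * card F)"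
    by (simp add: cardJ flip: power_sum)
  also have "\<dots> = (1 / 4) ^ card F"
    by (simp add: power_mult power2_eq_square)
  finally show ?thesis .
qed

section \<open>Percolation as an infinite cluster\<close>

lemma sets_ung_edge:
  assumes "x \<in> zd d"
  shows "{\<omega> \<in> space (choice_space d k). ung_edge \<omega> x y} \<in> sets (choice_space d k)"
proof (cases "y \<in> nbrs x")
  case True
  then have y: "y \<in> zd d"
    using assms by (auto simp: nbrs_def zd_def)
  have m: "{\<omega> \<in> space (choice_space d k). u \<in> \<omega> v} \<in> sets (choice_space d k)"
    if "v \<in> zd d" for u v
  proof -
    have "(\<lambda>\<omega>. \<omega> v) \<in> measurable (choice_space d k)
        (measure_pmf (pmf_of_set {S. S \<subseteq> nbrs v \<and> card S = k}))"
      unfolding choice_space_def by (rule measurable_component_singleton[OF that])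
    from measurable_sets[OF this, of "{S. u \<in> S}"] show ?thesis
      by (simp add: vimage_def Int_def conj_commute)
  qed
  have "{\<omega> \<in> space (choice_space d k). ung_edge \<omega> x y}
      = {\<omega> \<in> space (choice_space d k). y \<in> \<omega> x} \<union> {\<omega> \<in> space (choice_space d k). x \<in> \<omega> y}"
    using True by (auto simp: ung_edge_def)
  then show ?thesis
    using m assms y by simp
qed (simp add: ung_edge_def)

text \<open>A path is split after its first edge, for which only finitely many endpoints are
  possible, whatever the configuration.\<close>

lemma sets_ung_relpow:
  assumes "x \<in> zd d"
  shows "{\<omega> \<in> space (choice_space d k). (x, y) \<in> {(u, v). ung_edge \<omega> u v} ^^ n}
    \<in> sets (choice_space d k)"
  using assms
proof (induction n arbitrary: x)
  case 0
  show ?case by (cases "x = y") auto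
next
  case (Suc n)
  have "{\<omega> \<in> space (choice_space d k). (x, y) \<in> {(u, v). ung_edge \<omega> u v} ^^ Suc n}
    = (\<Union>z\<in>nbrs x. {\<omega> \<in> space (choice_space d k). ung_edge \<omega> x z} \<inter>
        {\<omega> \<in> space (choice_space d k). (z, y) \<in> {(u, v). ung_edge \<omega> u v} ^^ n})"
  proof -
    have "(x, y) \<in> r ^^ Suc n \<longleftrightarrow> (\<exists>z. (x, z) \<in> r \<and> (z, y) \<in> r ^^ n)"
      for r :: "(int list \<times> int list) set"
      by (meson relpow_Suc_D2 relpow_Suc_I2)
    then show ?thesis
      by (auto simp: ung_edge_def simp del: relpow.simps)
  qed
  also have "\<dots> \<in> sets (choice_space d k)"
    using Suc finite_nbrs
    by (intro sets.finite_UN sets.Int sets_ung_edge) (auto simp: nbrs_def zd_def)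
  finally show ?case .
qed

lemma infinite_self_avoiding_path:
  fixes r :: "('a \<times> 'a) set"
  assumes fin: "\<And>x. finite (r `` {x})"
    and inf: "infinite (r\<^sup>* `` {o'})"
  obtains p :: "nat \<Rightarrow> 'a" where "p 0 = o'" "inj p" "\<And>n. (p n, p (Suc n)) \<in> r"
proof -
  \<comment> \<open>The path is a geodesic ray: every \<open>p n\<close> is at distance \<open>n\<close> from \<open>o'\<close> and has infinitely
    many points behind it along geodesics from \<open>o'\<close>.\<close>
  define dst where "dst y = (LEAST n. (o', y) \<in> r ^^ n)" for y
  have dst: "(o', y) \<in> r ^^ dst y" if "(o', y) \<in> r ^^ n" for y n
    unfolding dst_def using that by (rule LeastI)
  have dst_le: "dst y \<le> n" if "(o', y) \<in> r ^^ n" for y n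
    unfolding dst_def using that by (rule Least_le)
  \<comment> \<open>For \<open>v\<close> at distance \<open>n\<close> from \<open>o'\<close>, these
    are the points with a geodesic from \<open>o'\<close> through \<open>v\<close>.\<close>
  define T where "T n v = {y. \<exists>m. (v, y) \<in> r ^^ m \<and> dst y = n + m}" for n v
  define P where "P n v \<longleftrightarrow> (o', v) \<in> r ^^ n \<and> dst v = n \<and> infinite (T n v)" for n v
  have step: "\<exists>w. P (Suc n) w \<and> (v, w) \<in> r" if "P n v" for n v
  proof -
    let ?W = "{w \<in> r `` {v}. dst w = Suc n}"
    have v: "(o', v) \<in> r ^^ n" "infinite (T n v)"
      using that by (auto simp: P_def)
    have "T n v \<subseteq> insert v (\<Union>w\<in>?W. T (Suc n) w)"
    proof
      fix y assume "y \<in> T n v"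
      then obtain m where m: "(v, y) \<in> r ^^ m" "dst y = n + m"
        by (auto simp: T_def)
      show "y \<in> insert v (\<Union>w\<in>?W. T (Suc n) w)"
      proof (cases m)
        case 0
        then show ?thesis using m by simp
      next
        case (Suc l)
        obtain w where w: "(v, w) \<in> r" "(w, y) \<in> r ^^ l"
          using relpow_Suc_D2[OF m(1)[unfolded Suc]] by blast
        have ow: "(o', w) \<in> r ^^ Suc n"
          using v(1) w(1) by (rule relpow_Suc_I)
        \<comment> \<open>A shorter way to \<open>w\<close> would bring \<open>y\<close> closer to
          \<open>o'\<close> than \<open>n + m\<close>, so \<open>w\<close> is at distance exactly
          \<open>Suc n\<close>.\<close>
        have "(o', y) \<in> r ^^ (dst w + l)"
          using dst[OF ow] w(2) unfolding relpow_add by (rule relcompI)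
        then have "n + m \<le> dst w + l"
          using dst_le[of y "dst w + l"] m(2) by simp
        then have "dst w = Suc n"
          using dst_le[OF ow] Suc by simp
        then show ?thesis
          using w m(2) Suc by (auto simp: T_def)
      qed
    qed
    then have "infinite (\<Union>w\<in>?W. T (Suc n) w)"
      using v(2) finite_subset by blast
    moreover have "finite ?W"
      by (rule finite_subset[OF _ fin[of v]]) auto
    ultimately obtain w where "w \<in> ?W" "infinite (T (Suc n) w)"
      using finite_UN by blast
    then show ?thesis
      using v(1) by (auto simp: P_def)
  qed
  have "dst o' = 0"
    using dst_le[of o' 0] by simp
  moreover have "r\<^sup>* `` {o'} \<subseteq> T 0 o'"
    using dst by (auto simp: T_def rtrancl_power)
  ultimately have P0: "P 0 o'"
    using inf finite_subset by (auto simp: P_def)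
  \<comment> \<open>The clause for \<open>n = 0\<close> pins the start of the path at
    \<open>o'\<close>.\<close>
  have "\<exists>p. \<forall>n. (P n (p n) \<and> (n = 0 \<longrightarrow> p n = o')) \<and> (p n, p (Suc n)) \<in> r"
    by (rule dependent_nat_choice) (use P0 step in auto)
  then obtain p where p: "\<And>n. P n (p n)" "p 0 = o'" "\<And>n. (p n, p (Suc n)) \<in> r"
    by blast
  have "inj p"
  proof (rule injI)
    fix m n assume "p m = p n"
    with p(1)[of m] p(1)[of n] show "m = n" by (simp add: P_def)
  qed
  with p that show thesis by blast
qed

text \<open>A self-avoiding path visits infinitely many vertices; conversely, all degrees are
  finite, so an infinite cluster contains a geodesic ray.\<close>

lemma perc_event_eq:
  "perc_event d k = {\<omega> \<in> space (choice_space d k).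
     infinite ({(x, y). ung_edge \<omega> x y}\<^sup>* `` {replicate d 0})}"
proof (intro set_eqI iffI)
  fix \<omega> assume "\<omega> \<in> perc_event d k"
  then obtain p where p: "p 0 = replicate d 0" "inj p" "\<And>n. ung_edge \<omega> (p n) (p (Suc n))"
      and sp: "\<omega> \<in> space (choice_space d k)"
    unfolding perc_event_def by blast
  have "(p 0, p n) \<in> {(x, y). ung_edge \<omega> x y}\<^sup>*" for n
    by (induction n) (use p(3) in \<open>auto intro: rtrancl_into_rtrancl\<close>)
  then have "range p \<subseteq> {(x, y). ung_edge \<omega> x y}\<^sup>* `` {replicate d 0}"
    using p(1) by auto
  then show "\<omega> \<in> {\<omega> \<in> space (choice_space d k).
     infinite ({(x, y). ung_edge \<omega> x y}\<^sup>* `` {replicate d 0})}"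
    using sp range_inj_infinite[OF p(2)] finite_subset by blast
next
  fix \<omega> assume w: "\<omega> \<in> {\<omega> \<in> space (choice_space d k).
     infinite ({(x, y). ung_edge \<omega> x y}\<^sup>* `` {replicate d 0})}"
  have "finite ({(x, y). ung_edge \<omega> x y} `` {x})" for x
    by (rule finite_subset[OF _ finite_nbrs[of x]]) (auto simp: ung_edge_def)
  then show "\<omega> \<in> perc_event d k"
    using infinite_self_avoiding_path[of "{(x, y). ung_edge \<omega> x y}" "replicate d 0"] w
    unfolding perc_event_def by simp blast
qed

text \<open>The definition quantifies over uncountably many paths. An infinite cluster is one that
  is unbounded in the enumeration \<open>to_nat\<close> of the vertices, which takes only countable
  quantifiers.\<close>

lemma sets_perc_event: "perc_event d k \<in> sets (choice_space d k)"
proof -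
  have "infinite R \<longleftrightarrow> (\<forall>m. \<exists>y. m \<le> to_nat y \<and> y \<in> R)" for R :: "int list set"
  proof -
    have "infinite R \<longleftrightarrow> infinite (to_nat ` R)"
      by (simp add: finite_image_iff inj_on_def)
    then show ?thesis
      unfolding infinite_nat_iff_unbounded_le by blast
  qed
  then have "perc_event d k = {\<omega> \<in> space (choice_space d k). \<forall>m. \<exists>y. m \<le> to_nat y \<and>
      (\<exists>n. (replicate d 0, y) \<in> {(x, y). ung_edge \<omega> x y} ^^ n)}"
    unfolding perc_event_eq by (simp add: rtrancl_power)
  also have "\<dots> \<in> sets (choice_space d k)"
    by (intro sets.sets_Collect sets_ung_relpow) (simp add: zd_def)
  finally show ?thesis .
qed

section \<open>Contours in the quadrant\<close>

type_synonym cell = "int \<times> int"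

definition quadrant :: "cell set" where
  "quadrant = {0..} \<times> {0..}"

definition directions :: "cell set" where
  "directions = {(1, 0), (0, 1), (-1, 0), (0, -1)}"

fun rot :: "cell \<Rightarrow> cell" where
  "rot (a, b) = (-b, a)"

lemma rot_in_directions: "r \<in> directions \<Longrightarrow> rot r \<in> directions" "r \<in> directions \<Longrightarrow> -r \<in> directions"
  by (auto simp: directions_def)

text \<open>
  A pair \<open>(x, e)\<close> stands for the dual edge separating the cells \<open>x\<close> and \<open>x + e\<close>, directed
  along \<open>rot e\<close>, so that \<open>x\<close> is on its left. It can be continued to the right (0), straight
  on (1) or to the left (2).
\<close>

fun turn :: "nat \<Rightarrow> cell \<times> cell \<Rightarrow> cell \<times> cell" where
  "turn t (x, e) =
    (if t = 0 then (x + e + rot e, - rot e) else if t = 1 then (x + rot e, e) else (x, rot e))"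

fun walk :: "cell \<times> cell \<Rightarrow> nat list \<Rightarrow> (cell \<times> cell) list" where
  "walk b [] = [b]"
| "walk b (t # ts) = b # walk (turn t b) ts"

text \<open>Since the outer cell must lie in the quadrant, the sides of the quadrant contribute no
  dual edges, and contours may start and end there.\<close>

definition boundary :: "cell set \<Rightarrow> (cell \<times> cell) set" where
  "boundary C = {(x, e). e \<in> directions \<and> x \<in> C \<and> x + e \<in> quadrant - C}"

text \<open>If only the two diagonal cells \<open>x\<close> and \<open>x + e + rot e\<close> around
  the head are in \<open>C\<close>, the contour turns right. This fixed tie-break keeps the step
  injective.\<close>

definition contour_step :: "cell set \<Rightarrow> cell \<times> cell \<Rightarrow> cell \<times> cell" where
  "contour_step C = (\<lambda>(x, e). turn
     (if x + e + rot e \<in> C then 0 else if x + rot e \<in> C then 1 else 2) (x, e))"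

definition continuing :: "cell set \<Rightarrow> (cell \<times> cell) set" where
  "continuing C = {(x, e) \<in> boundary C. x + rot e \<in> quadrant}"

text \<open>\<open>entry i\<close> and \<open>exit i\<close> are the two orientations of one dual
  edge on the bottom row: upward into the quadrant with \<open>(i, 0)\<close> inside, and downward
  out of it with \<open>(i + 1, 0)\<close> inside.\<close>

abbreviation entry :: "nat \<Rightarrow> cell \<times> cell" where
  "entry i \<equiv> ((int i, 0), (1, 0))"

abbreviation exit :: "nat \<Rightarrow> cell \<times> cell" where
  "exit i \<equiv> ((int (Suc i), 0), (-1, 0))"

text \<open>
  Twice the second minus the first coordinate of the head \<open>x + (e + rot e) / 2\<close> of the dual edge.
\<close>

fun height :: "cell \<times> cell \<Rightarrow> int" where
  "height ((a, b), e) = 2 * (b - a) + snd (e + rot e) - fst (e + rot e)"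

lemma contour_step_boundary:
  assumes C: "C \<subseteq> quadrant" and "b \<in> continuing C"
  shows "contour_step C b \<in> boundary C"
proof -
  obtain x e where b: "b = (x, e)" "e \<in> directions" "x \<in> C" "x + e \<in> quadrant" "x + e \<notin> C"
      "x + rot e \<in> quadrant"
    using assms(2) by (auto simp: continuing_def boundary_def)
  have "x \<in> quadrant"
    using b(3) C by blast
  \<comment> \<open>The fourth cell around the head is in the quadrant as soon as the other three
    are.\<close>
  then have q: "x + rot e + e \<in> quadrant"
    using b(2,4,6) by (auto simp: directions_def quadrant_def)
  show ?thesis
    using b q by (simp add: contour_step_def boundary_def rot_in_directions algebra_simps)
qed

lemma inj_on_contour_step:
  assumes "C \<subseteq> quadrant"
  shows "inj_on (contour_step C) (continuing C)"
proof (rule inj_on_inverseI)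
  \<comment> \<open>the two cells behind a dual edge determine the turn by which it was reached\<close>
  let ?back = "\<lambda>(x, e). if x + e - rot e \<in> C then (x + e - rot e, rot e)
    else if x - rot e \<in> C then (x - rot e, e) else (x, - rot e)"
  fix b assume "b \<in> continuing C"
  then obtain x e where b: "b = (x, e)" "e \<in> directions" "x \<in> C" "x + e \<notin> C"
    by (auto simp: continuing_def boundary_def)
  have r: "rot (rot e) = - e" "rot (- rot e) = e"
    using b(2) by (auto simp: directions_def)
  show "?back (contour_step C b) = b"
    using b(3,4) by (simp add: b(1) contour_step_def r algebra_simps)
qed

text \<open>Whichever turn led to \<open>entry i\<close>, one of the cells \<open>x\<close> and
  \<open>x + e\<close> of the preceding dual edge would have second coordinate -1.\<close>

lemma entry_not_step:
  assumes "b \<in> continuing C" and C: "C \<subseteq> quadrant"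
  shows "entry i \<noteq> contour_step C b"
proof -
  obtain x e where b: "b = (x, e)" "e \<in> directions" "x \<in> C" "x + e \<in> quadrant"
    using assms(1) by (auto simp: continuing_def boundary_def)
  obtain x1 x2 where x: "x = (x1, x2)" "0 \<le> x2"
    using b(3) C by (cases x) (auto simp: quadrant_def)
  have "contour_step C b \<in> {(x + e + rot e, - rot e), (x + rot e, e), (x, rot e)}"
    by (simp add: b(1) contour_step_def)
  then show ?thesis
    using b(2,4) x(2) unfolding x(1) directions_def quadrant_def
    by (elim insertE emptyE) simp_all
qed

text \<open>A contour can only stop heading down on the bottom side, which is an exit, or heading
  left on the left side. There \<open>e = (0, 1)\<close> and the first coordinate is 0, so the
  height is twice the second coordinate plus 2.\<close>

lemma height_contour_end:
  assumes "C \<subseteq> quadrant" "b \<in> boundary C" "b \<notin> continuing C" "b \<notin> range exit"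
  shows "height b \<ge> 2"
proof -
  obtain x1 x2 e where b: "b = ((x1, x2), e)"
    by (metis surj_pair)
  have "b = exit (nat (x1 - 1))" if "e = (-1, 0)"
    using that assms by (auto simp: b continuing_def boundary_def quadrant_def)
  then have "e \<noteq> (-1, 0)"
    using assms(4) by blast
  then show ?thesis
    using assms(1-3) by (auto simp: b continuing_def boundary_def directions_def quadrant_def)
qed

text \<open>Each of the three turns moves the head by one unit along an axis.\<close>

lemma height_contour_step:
  assumes "b \<in> boundary C"
  shows "height (contour_step C b) \<le> height b + 2"
proof -
  obtain x e where b: "b = (x, e)" "e \<in> directions"
    using assms by (auto simp: boundary_def)
  then show ?thesis
    by (cases x) (auto simp: contour_step_def directions_def)
qed

section \<open>Existence of a long contour, by counting entries and exits\<close>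

lemma finite_boundary: "finite C \<Longrightarrow> finite (boundary C)"
  by (rule finite_subset[of _ "C \<times> directions"]) (auto simp: boundary_def, simp add: directions_def)

text \<open>Switches off and on alternate, and the first is off because of \<open>P 0\<close>. On
  the bottom row the former are entries and the latter exits.\<close>

lemma card_down_steps:
  fixes P :: "nat \<Rightarrow> bool"
  assumes "P 0"
  shows "card {i. i < N \<and> P i \<and> \<not> P (Suc i)} + (if P N then 1 else 0)
     = card {i. i < N \<and> \<not> P i \<and> P (Suc i)} + 1"
proof (induction N)
  case (Suc N)
  have "{i. i < Suc N \<and> P i \<and> \<not> P (Suc i)}
      = (if P N \<and> \<not> P (Suc N) then insert N else id) {i. i < N \<and> P i \<and> \<not> P (Suc i)}"
    "{i. i < Suc N \<and> \<not> P i \<and> P (Suc i)}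
      = (if \<not> P N \<and> P (Suc N) then insert N else id) {i. i < N \<and> \<not> P i \<and> P (Suc i)}"
    by (auto simp: less_Suc_eq)
  with Suc show ?case
    by (auto split: if_splits)
qed (simp add: assms)

text \<open>Orbits starting in \<open>S\<close> can neither merge nor cycle, because
  \<open>f\<close> is injective on \<open>D\<close> and points of \<open>S\<close> have no
  predecessor in \<open>D\<close>. In the finite set \<open>A\<close> they all leave
  \<open>D\<close>, at distinct points, and these are too many to fit into \<open>T\<close>.\<close>

lemma injective_escape:
  fixes f :: "'a \<Rightarrow> 'a"
  assumes "finite A" "D \<subseteq> A" "f ` D \<subseteq> A" "inj_on f D"
    and S: "S \<subseteq> A" "S \<inter> f ` D = {}" and T: "finite T" "card T < card S"
  obtains s n where "s \<in> S" "\<And>m. m < n \<Longrightarrow> (f ^^ m) s \<in> D" "(f ^^ n) s \<in> A - D - T"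
    "inj_on (\<lambda>m. (f ^^ m) s) {..n}"
proof -
  \<comment> \<open>Two orbits that meet are traced back by injectivity until one reaches its start;
    the other must then be at its start too.\<close>
  have coincide: "s = s' \<and> m = n"
    if "s \<in> S" "s' \<in> S" "\<forall>l<m. (f ^^ l) s \<in> D" "\<forall>l<n. (f ^^ l) s' \<in> D" "(f ^^ m) s = (f ^^ n) s'"
    for s s' m n
    using that
  proof (induction m arbitrary: n)
    case 0
    show ?case
    proof (cases n)
      case (Suc l)
      then have "s \<in> f ` D" using 0 by simp
      with 0 S show ?thesis by blast
    qed (use 0 in simp)
  next
    case (Suc m)
    show ?case
    proof (cases n)
      case 0
      then have "s' \<in> f ` D" using Suc.prems(3,5) by (metis funpow_0 funpow.simps(2) comp_apply imageI lessI)
      with Suc S show ?thesis by blast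
    next
      case (Suc l)
      then have "(f ^^ m) s = (f ^^ l) s'"
        using Suc.prems assms(4) by (simp add: inj_on_eq_iff)
      then show ?thesis
        using Suc Suc.IH[of l] Suc.prems by simp
    qed
  qed
  have inj: "inj_on (\<lambda>m. (f ^^ m) s) {..n}" if "s \<in> S" "\<forall>l<n. (f ^^ l) s \<in> D" for s n
  proof (rule inj_onI)
    fix a b assume "a \<in> {..n}" "b \<in> {..n}" "(f ^^ a) s = (f ^^ b) s"
    with that coincide[of s s a b] show "a = b" by auto
  qed
  have inA: "(f ^^ n) s \<in> A" if "s \<in> S" "\<forall>l<n. (f ^^ l) s \<in> D" for s n
    using that assms(3) S(1) by (cases n) auto
  have stop: "\<exists>n. (\<forall>l<n. (f ^^ l) s \<in> D) \<and> (f ^^ n) s \<notin> D" if s: "s \<in> S" for s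
  proof -
    have "\<exists>n. (f ^^ n) s \<notin> D"
    proof (rule ccontr)
      assume "\<nexists>n. (f ^^ n) s \<notin> D"
      then have all: "\<And>n. (f ^^ n) s \<in> D" by blast
      have "inj (\<lambda>m. (f ^^ m) s)"
        by (intro injI) (use coincide s all in blast)
      then have "infinite (range (\<lambda>m. (f ^^ m) s))"
        by (rule range_inj_infinite)
      moreover have "range (\<lambda>m. (f ^^ m) s) \<subseteq> A"
        using all assms(2) by auto
      ultimately show False
        using assms(1) finite_subset by blast
    qed
    then show ?thesis
      using exists_least_iff[of "\<lambda>n. (f ^^ n) s \<notin> D"] by auto
  qed
  then obtain N where N: "\<And>s. s \<in> S \<Longrightarrow> (\<forall>l<N s. (f ^^ l) s \<in> D) \<and> (f ^^ N s) s \<notin> D"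
    by metis
  have "inj_on (\<lambda>s. (f ^^ N s) s) S"
    by (intro inj_onI) (use coincide N in blast)
  then have "card ((\<lambda>s. (f ^^ N s) s) ` S) = card S"
    by (rule card_image)
  then have "\<not> (\<lambda>s. (f ^^ N s) s) ` S \<subseteq> T"
    using T card_mono[of T] by (metis not_le)
  then obtain s where "s \<in> S" "(f ^^ N s) s \<notin> T"
    by blast
  then show thesis
    using that[of s "N s"] N[of s] inA[of s "N s"] inj[of s "N s"] by blast
qed

text \<open>A contour is coded by a word over three letters that no longer mentions
  \<open>C\<close>, so there are at most \<open>3 ^ n\<close> candidates to sum over.\<close>

lemma walk_contour:
  "\<exists>ts \<in> {ts. set ts \<subseteq> {..<3} \<and> length ts = n}.
     walk b ts = map (\<lambda>m. (contour_step C ^^ m) b) [0..<Suc n]"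
proof (induction n arbitrary: b)
  case (Suc n)
  obtain x e where b: "b = (x, e)" by (cases b)
  define t :: nat where "t = (if x + e + rot e \<in> C then 0 else if x + rot e \<in> C then 1 else 2)"
  have t: "t < 3" "contour_step C b = turn t b"
    by (auto simp: t_def contour_step_def b)
  obtain ts where ts: "set ts \<subseteq> {..<3}" "length ts = n"
      "walk (turn t b) ts = map (\<lambda>m. (contour_step C ^^ m) (turn t b)) [0..<Suc n]"
    using Suc[of "turn t b"] by blast
  have "[0..<Suc (Suc n)] = 0 # map Suc [0..<Suc n]"
    by (simp add: map_Suc_upt upt_conv_Cons del: upt_Suc)
  then have "walk b (t # ts) = map (\<lambda>m. (contour_step C ^^ m) b) [0..<Suc (Suc n)]"
    using ts(3) t(2) by (simp add: funpow_swap1 comp_def del: upt_Suc)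
  with ts t(1) show ?case
    by (intro bexI[of _ "t # ts"]) auto
qed auto

lemma long_contour:
  assumes fin: "finite C" and C: "C \<subseteq> quadrant" "(0, 0) \<in> C"
  obtains i ts where "length ts = Suc i" "set ts \<subseteq> {..<3}"
    "distinct (walk (entry i) ts)" "set (walk (entry i) ts) \<subseteq> boundary C"
proof -
  let ?f = "contour_step C"
  define P where "P i \<longleftrightarrow> (int i, 0) \<in> C" for i :: nat
  have "finite ((\<lambda>i. (int i, 0 :: int)) -` C)"
    using fin by (intro finite_vimageI) (auto simp: inj_def)
  then obtain N where N: "\<And>i. P i \<Longrightarrow> i < N"
    unfolding P_def by (metis finite_nat_set_iff_bounded vimageI)
  let ?I = "{i. i < N \<and> P i \<and> \<not> P (Suc i)}" and ?O = "{i. i < N \<and> \<not> P i \<and> P (Suc i)}"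
  \<comment> \<open>\<open>P N\<close> is false, so the surplus of entries is exactly one.\<close>
  have "card ?I = card ?O + 1"
    using card_down_steps[of P N] N C by (auto simp: P_def split: if_splits)
  moreover have "card (entry ` ?I) = card ?I" "card (exit ` ?O) = card ?O"
    by (auto intro!: card_image simp: inj_on_def)
  ultimately have card: "card (exit ` ?O) < card (entry ` ?I)"
    by simp
  have S: "entry ` ?I \<subseteq> boundary C"
    by (auto simp: boundary_def P_def directions_def quadrant_def add.commute)
  have exitO: "i \<in> ?O" if "exit i \<in> boundary C" for i
    using that N[of "Suc i"] by (auto simp: boundary_def P_def quadrant_def)
  obtain s n where s: "s \<in> entry ` ?I" "\<And>m. m < n \<Longrightarrow> (?f ^^ m) s \<in> continuing C"
      "(?f ^^ n) s \<in> boundary C - continuing C - exit ` ?O"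
      "inj_on (\<lambda>m. (?f ^^ m) s) {..n}"
  proof (rule injective_escape)
    show "finite (boundary C)" using fin by (rule finite_boundary)
    show "continuing C \<subseteq> boundary C" by (auto simp: continuing_def)
    show "?f ` continuing C \<subseteq> boundary C" using contour_step_boundary[OF C(1)] by blast
    show "inj_on ?f (continuing C)" using C(1) by (rule inj_on_contour_step)
    show "entry ` ?I \<inter> ?f ` continuing C = {}" using entry_not_step[OF _ C(1)] by blast
    show "entry ` ?I \<subseteq> boundary C" by (fact S)
    show "card (exit ` ?O) < card (entry ` ?I)" by (fact card)
    show "finite (exit ` ?O)" by simp
  qed blast
  then obtain i where i: "s = entry i" by blast
  have bd: "(?f ^^ m) s \<in> boundary C" if "m \<le> n" for m
    using that s(2)[of m] s(3) by (cases "m = n") (auto simp: continuing_def)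
  have "(?f ^^ n) s \<notin> range exit"
  proof
    assume "(?f ^^ n) s \<in> range exit"
    then obtain j where j: "(?f ^^ n) s = exit j" by blast
    then have "exit j \<in> boundary C" using s(3) by simp
    then have "exit j \<in> exit ` ?O" by (intro imageI exitO)
    with j s(3) show False by simp
  qed
  then have "height ((?f ^^ n) s) \<ge> 2"
    using s(3) C(1) by (intro height_contour_end) auto
  \<comment> \<open>The height of \<open>entry i\<close> is \<open>- 2 * i\<close>. To reach 2 in
    increments of at most 2 takes at least \<open>i + 1\<close> steps.\<close>
  moreover have "height ((?f ^^ m) s) \<le> 2 * int m - 2 * int i" if "m \<le> n" for m
    using that
  proof (induction m)
    case (Suc m)
    then show ?case using height_contour_step[OF bd[of m]] by simp
  qed (simp add: i)
  ultimately have len: "Suc i \<le> n"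
    by fastforce
  \<comment> \<open>The contour is cut after \<open>i + 1\<close> steps, so that its length depends
    on the entry alone.\<close>
  obtain ts where ts: "set ts \<subseteq> {..<3}" "length ts = Suc i"
      "walk (entry i) ts = map (\<lambda>m. (?f ^^ m) (entry i)) [0..<Suc (Suc i)]"
    using walk_contour[of "Suc i" "entry i" C] by blast
  show thesis
  proof (rule that[OF ts(2,1)])
    show "distinct (walk (entry i) ts)"
      unfolding ts(3) distinct_map using len
      by (intro conjI inj_on_subset[OF s(4)[unfolded i]]) auto
    show "set (walk (entry i) ts) \<subseteq> boundary C"
      unfolding ts(3) using len bd i by (auto simp del: upt_Suc funpow.simps)
  qed
qed

lemma length_walk: "length (walk b ts) = Suc (length ts)"
  by (induction ts arbitrary: b) auto

section \<open>The union bound\<close>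

text \<open>The plane of the first two axes. As \<open>d - 2\<close> is truncated, the result lies
  in \<open>zd d\<close> only for \<open>d\<close> at least 2.\<close>

definition embed :: "nat \<Rightarrow> cell \<Rightarrow> int list" where
  "embed d x = fst x # snd x # replicate (d - 2) 0"

definition embed_edge :: "nat \<Rightarrow> cell \<times> cell \<Rightarrow> int list \<times> int list" where
  "embed_edge d b = (embed d (fst b), embed d (fst b + snd b))"

lemma embed_eq_iff: "embed d x = embed d y \<longleftrightarrow> x = y"
  by (auto simp: embed_def prod_eq_iff)

lemma embed_origin:
  assumes "2 \<le> d"
  shows "embed d (0, 0) = replicate d 0"
proof -
  obtain k where "d = Suc (Suc k)"
    using assms by (metis add_2_eq_Suc le_Suc_ex)
  then show ?thesis
    by (simp add: embed_def)
qed

lemma embed_zd: "2 \<le> d \<Longrightarrow> embed d x \<in> zd d"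
  by (auto simp: embed_def zd_def)

lemma embed_nbrs:
  assumes "e \<in> directions"
  shows "embed d (x + e) \<in> nbrs (embed d x)"
proof -
  have "(\<Sum>i<length (embed d x). \<bar>embed d x ! i - embed d (x + e) ! i\<bar>) = 1"
    using assms unfolding embed_def
    by (auto simp: sum.lessThan_Suc_shift directions_def simp del: sum.lessThan_Suc)
  then show ?thesis
    by (simp add: nbrs_def embed_def)
qed

lemma inj_embed_edge: "inj (embed_edge d)"
  by (auto simp: inj_def embed_edge_def embed_eq_iff)

definition closed_event :: "nat \<Rightarrow> (cell \<times> cell) list \<Rightarrow> (int list \<Rightarrow> int list set) set" where
  "closed_event d L = {\<omega> \<in> space (choice_space d d).
     \<forall>(x, y) \<in> embed_edge d ` set L. \<not> ung_edge \<omega> x y}"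

text \<open>These candidates do not depend on the configuration. Distinctness and the absence of
  reversed pairs make the \<open>i + 2\<close> crossed edges distinct as undirected edges.\<close>

definition contours :: "nat \<Rightarrow> nat \<Rightarrow> (cell \<times> cell) list set" where
  "contours d i = {L \<in> walk (entry i) ` {ts. set ts \<subseteq> {..<3} \<and> length ts = Suc i}.
     distinct L \<and> snd ` set L \<subseteq> directions \<and>
     embed_edge d ` set L \<inter> (embed_edge d ` set L)\<inverse> = {}}"

lemma prob_space_choice_space: "prob_space (choice_space d k)"
  unfolding choice_space_def by (intro prob_space_PiM prob_space_measure_pmf)

lemma sets_closed_event:
  assumes "2 \<le> d"
  shows "closed_event d L \<in> sets (choice_space d d)"
proof -
  have "closed_event d L = space (choice_space d d) -
      (\<Union>b\<in>set L. {\<omega> \<in> space (choice_space d d).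
          ung_edge \<omega> (embed d (fst b)) (embed d (fst b + snd b))})"
    by (auto simp: closed_event_def embed_edge_def)
  also have "\<dots> \<in> sets (choice_space d d)"
    using assms by (intro sets.Diff sets.top sets.finite_UN sets_ung_edge embed_zd) auto
  finally show ?thesis .
qed

lemma prob_closed_event_le:
  assumes "2 \<le> d" "L \<in> contours d i"
  shows "measure (choice_space d d) (closed_event d L) \<le> (1 / 4) ^ (i + 2)"
proof -
  have L: "length L = i + 2" "distinct L" "snd ` set L \<subseteq> directions"
      "embed_edge d ` set L \<inter> (embed_edge d ` set L)\<inverse> = {}"
    using assms(2) by (auto simp: contours_def length_walk)
  have "card (embed_edge d ` set L) = i + 2"
    using L(1,2) by (simp add: card_image inj_on_subset[OF inj_embed_edge] distinct_card)
  moreover have "x \<in> zd d \<and> y \<in> nbrs x" if "(x, y) \<in> embed_edge d ` set L" for x y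
    using that L(3) by (auto simp: embed_edge_def embed_zd[OF assms(1)] intro!: embed_nbrs)
  ultimately show ?thesis
    using prob_closed_le[of "embed_edge d ` set L" d] L(4)
    by (auto simp: closed_event_def disjoint_iff)
qed

lemma finite_contours: "finite (contours d i)"
  and card_contours_le: "card (contours d i) \<le> 3 ^ Suc i"
proof -
  let ?T = "{ts. set ts \<subseteq> {..<3 :: nat} \<and> length ts = Suc i}"
  have T: "finite ?T" "card ?T = 3 ^ Suc i"
    by (simp_all add: finite_lists_length_eq card_lists_length_eq del: power_Suc)
  have sub: "contours d i \<subseteq> walk (entry i) ` ?T"
    by (auto simp: contours_def)
  show "finite (contours d i)"
    using sub T(1) finite_subset by blast
  have "card (contours d i) \<le> card (walk (entry i) ` ?T)"
    using sub T(1) by (intro card_mono) auto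
  also have "\<dots> \<le> 3 ^ Suc i"
    using card_image_le[OF T(1)] T(2) by metis
  finally show "card (contours d i) \<le> 3 ^ Suc i" .
qed

text \<open>The contour surrounds parts of the trace \<open>C\<close> of the cluster, which may be
  disconnected. An open edge across it would put its outer cell into the cluster and hence into
  \<open>C\<close>.\<close>

lemma finite_cluster_closed_contour:
  assumes "2 \<le> d" and sp: "\<omega> \<in> space (choice_space d d)"
    and fin: "finite ({(x, y). ung_edge \<omega> x y}\<^sup>* `` {replicate d 0})"
  obtains i L where "L \<in> contours d i" "\<omega> \<in> closed_event d L"
proof -
  let ?K = "{(x, y). ung_edge \<omega> x y}\<^sup>* `` {replicate d 0}"
  define C where "C = {c \<in> quadrant. embed d c \<in> ?K}"
  have "C \<subseteq> embed d -` ?K"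
    by (auto simp: C_def)
  moreover have "finite (embed d -` ?K)"
    using fin by (intro finite_vimageI) (auto simp: inj_def embed_eq_iff)
  ultimately have "finite C"
    using finite_subset by blast
  moreover have "C \<subseteq> quadrant" "(0, 0) \<in> C"
    using embed_origin[OF assms(1)] by (auto simp: C_def quadrant_def)
  ultimately obtain i ts where ts: "length ts = Suc i" "set ts \<subseteq> {..<3}"
      "distinct (walk (entry i) ts)" "set (walk (entry i) ts) \<subseteq> boundary C"
    by (rule long_contour)
  let ?L = "walk (entry i) ts"
  have bd: "\<exists>u v. x = embed d u \<and> y = embed d v \<and> u \<in> C \<and> v \<in> quadrant - C"
    if "(x, y) \<in> embed_edge d ` set ?L" for x y
    using that ts(4) by (fastforce simp: embed_edge_def boundary_def)
  show thesis
  proof (rule that)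
    \<comment> \<open>Every pair leads from a cell of \<open>C\<close> to a cell outside
      \<open>C\<close>, so its reverse cannot occur.\<close>
    have "(y, x) \<notin> embed_edge d ` set ?L" if "(x, y) \<in> embed_edge d ` set ?L" for x y
      using bd[OF that] bd[of y x] by (metis DiffD2 embed_eq_iff)
    then have "embed_edge d ` set ?L \<inter> (embed_edge d ` set ?L)\<inverse> = {}"
      by fast
    moreover have "snd ` set ?L \<subseteq> directions"
      using ts(4) by (auto simp: boundary_def)
    ultimately show "?L \<in> contours d i"
      using ts(1-3) by (simp add: contours_def)
    have "\<not> ung_edge \<omega> x y" if xy: "(x, y) \<in> embed_edge d ` set ?L" for x y
    proof
      assume e: "ung_edge \<omega> x y"
      obtain u v where "x = embed d u" "y = embed d v" "u \<in> C" "v \<in> quadrant" "v \<notin> C"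
        using bd[OF xy] by blast
      moreover from this e have "y \<in> ?K"
        by (auto simp: C_def intro: rtrancl_into_rtrancl)
      ultimately show False
        by (simp add: C_def)
    qed
    then show "\<omega> \<in> closed_event d ?L"
      using sp unfolding closed_event_def by blast
  qed
qed

lemma theta_U_ge:
  assumes d: "2 \<le> d"
  shows "theta_U d d \<ge> 1 / 4"
proof -
  let ?M = "choice_space d d"
  interpret prob_space ?M
    by (rule prob_space_choice_space)
  define B where "B i = (\<Union>L\<in>contours d i. closed_event d L)" for i
  have sB: "B i \<in> sets ?M" for i
    unfolding B_def using d by (intro sets.finite_UN finite_contours sets_closed_event)
  have pB: "prob (B i) \<le> 3 / 16 * (3 / 4) ^ i" for i
  proof -
    have "prob (B i) \<le> (\<Sum>L\<in>contours d i. prob (closed_event d L))"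
      unfolding B_def using d
      by (intro finite_measure_subadditive_finite finite_contours) (auto intro: sets_closed_event)
    also have "\<dots> \<le> real (card (contours d i)) * (1 / 4) ^ (i + 2)"
      using d by (intro sum_bounded_above prob_closed_event_le)
    also have "\<dots> \<le> real (3 ^ Suc i) * (1 / 4) ^ (i + 2)"
      using card_contours_le[of d i] by (intro mult_right_mono of_nat_mono) auto
    also have "\<dots> = 3 / 16 * (3 / 4) ^ i"
      by (simp add: power_divide power_add)
    finally show ?thesis .
  qed
  \<comment> \<open>The geometric series has sum
    \<open>(3 / 16) / (1 - 3 / 4) = 3 / 4\<close>.\<close>
  have geo: "(\<lambda>i. 3 / 16 * (3 / 4) ^ i) sums (3 / 4 :: real)"
    using sums_mult[OF geometric_sums[of "3 / 4 :: real"], of "3 / 16"] by simp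
  have sum: "summable (\<lambda>i. prob (B i))"
    by (rule summable_comparison_test'[OF sums_summable[OF geo], of 0]) (use pB in simp)
  have "prob (\<Union>i. B i) \<le> (\<Sum>i. prob (B i))"
    using sB sum by (intro finite_measure_subadditive_countably) auto
  also have "\<dots> \<le> (\<Sum>i. 3 / 16 * (3 / 4) ^ i)"
    using pB sum sums_summable[OF geo] by (rule suminf_le)
  also have "\<dots> = 3 / 4"
    using sums_unique[OF geo] by simp
  finally have "1 / 4 \<le> prob (space ?M - (\<Union>i. B i))"
    using sB by (subst prob_compl) auto
  \<comment> \<open>Where no candidate contour is closed, the cluster of the origin cannot be
    finite.\<close>
  also have "space ?M - (\<Union>i. B i) \<subseteq> perc_event d d"
    using finite_cluster_closed_contour[OF d] unfolding perc_event_eq B_def by blast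
  then have "prob (space ?M - (\<Union>i. B i)) \<le> prob (perc_event d d)"
    by (intro finite_measure_mono sets_perc_event)
  finally show ?thesis
    by (simp add: theta_U_def)
qed

theorem theorem2p9:
  shows "theta_U 2 2 > 0 \<and> theta_U 3 3 > 0"
  using theta_U_ge[of 2] theta_U_ge[of 3] by simp

end
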